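(* Let $\Delta\ge 6$ and let $n=k\Delta+1+j$, where $k\geq\Delta-1$ and $1\leq j\leq\Delta-1$ are integers, and let $r(\Delta)=\frac{1}{2}\left(\sqrt{5\Delta^{2}-32\Delta+44}-\Delta+4\right)$, which is the positive root of the polynomial $q(x)=x^{2}+(\Delta-4)x-(\Delta^{2}-6\Delta+7)$. Then the following holds: (i) $\sigma'>\sigma''$ if $j<r(\Delta)$; (ii) $\sigma'=\sigma''$ if $j=r(\Delta)$; (iii) $\sigma''>\sigma'$ if $j>r(\Delta)$; (iv) for $2\leq j\leq\Delta-2$ it holds that $\sigma'''<\max\{\sigma',\sigma''\}$, except in the following four cases: - if $j=2$ and $\Delta\geq 7$, then $\sigma'''=\sigma'+4>\max\{\sigma',\sigma''\}$; - if $(\Delta,j)=(8,3)$, then $\sigma'''=\sigma'+2>\max\{\sigma',\sigma''\}$; - if $(\Delta,j)=(6,2)$, then $\sigma'''=\sigma''>\sigma'$; - if $(\Delta,j)=(9,3)$, then $\sigma'''=\sigma'>\sigma''$.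
   Context: For a graph $G$, $\sigma(G)=\sum_{uv\in E(G)}(d(u)-d(v))^2$, where $d(u)$ is the degree of $u$. For a tree $T$, $n_i$ is the number of vertices of degree $i$, and $m_{ij}=m_{ji}$ is the number of edges whose end-vertices have degrees $i$ and $j$. An internal leaf of a tree is a vertex of degree at least $2$ having precisely one neighbor of degree greater than $1$. A medium vertex is a vertex whose degree lies in $\{3,\ldots,\Delta-1\}$. Let $n=k\Delta+1+j$. The following families consist of trees $T$ on $n$ vertices with maximum degree $\Delta$. $\mathcal{T}'_{n,\Delta}$: all such trees with (1) all internal leaves of $T$ have degree $\Delta$; (2) $m_{22}\le 2$ and $m_{\Delta\Delta}=0$; (3) $\sum_{i=3}^{\Delta-1}n_i\le 1$; (4) $m_{22}=0$ if and only if $\sum_{i=3}^{\Delta-1}n_i=n_a=1$ for some $a\in\{3,\ldots,\Delta-1\}$; (5) if $m_{22}=0$, then $m_{a2}=a$, where $a$ is the degree from (4). $\mathcal{T}''_{n,\Delta}$: all such trees with (1) all internal leaves of $T$ have degree $\Delta$; (2) all vertices have degree in $\{1,2,\Delta\}$; (3) $m_{22}=0$ and $m_{\Delta\Delta}\le\Delta-1$. $\mathcal{T}'''_{n,\Delta}$ (for $2\le j\le\Delta-2$): all such trees with (1) all internal leaves of $T$ have degree $\Delta$; (2) all vertices have degree in $\{1,2,\Delta\}$, except precisely one medium vertex $w$, which has degree $j+1$; (3) $m_{22}=0$; (4) $w$ has precisely $j$ neighbors of degree $2$ and one neighbor of degree $\Delta$; (5) $m_{\Delta\Delta}=0$. Each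 of these families is nonempty and all its trees have the same $\sigma$-irregularity; the common values are denoted $\sigma'$, $\sigma''$, $\sigma'''$, respectively. Explicitly, writing $B=\Delta^{3}k-2\Delta^{2}k-3\Delta k+6k$: $\sigma'=B+4\Delta-6$ for $j\le 2$ and $\sigma'=B+2\Delta j+j^3-4j^2+j$ for $j\ge 3$; $\sigma''=B-\Delta^{3}+2\Delta^{2}j+6\Delta^{2}-8\Delta j-7\Delta+8j$; $\sigma'''=B+4\Delta+j^3-j^2-6$. *)

theory Defs
  imports Complex_Main "HOL-Computational_Algebra.Polynomial"
begin

section \<open>Finite simple graphs and trees\<close>

record 'a graph =
  verts :: "'a set"
  edges :: "'a set set"

definition simple_graph :: "'a graph \<Rightarrow> bool" where
  "simple_graph G \<longleftrightarrow>
     finite (verts G) \<and>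
     (\<forall>e\<in>edges G. \<exists>u v. u \<in> verts G \<and> v \<in> verts G \<and> u \<noteq> v \<and> e = {u, v})"

definition neighbors :: "'a graph \<Rightarrow> 'a \<Rightarrow> 'a set" where
  "neighbors G v = {u \<in> verts G. {v, u} \<in> edges G}"

definition deg :: "'a graph \<Rightarrow> 'a \<Rightarrow> nat" where
  "deg G v = card (neighbors G v)"

definition max_deg :: "'a graph \<Rightarrow> nat" where
  "max_deg G = Max (deg G ` verts G)"

definition graph_connected :: "'a graph \<Rightarrow> bool" where
  "graph_connected G \<longleftrightarrow>
     verts G \<noteq> {} \<and>
     (\<forall>u\<in>verts G. \<forall>v\<in>verts G. (u, v) \<in> {(x, y). {x, y} \<in> edges G}\<^sup>*)"

text \<open>A cycle is given by the list of its vertices; the closing edge joins the last one to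
  the first one.\<close>

definition is_cycle :: "'a graph \<Rightarrow> 'a list \<Rightarrow> bool" where
  "is_cycle G xs \<longleftrightarrow>
     3 \<le> length xs \<and> distinct xs \<and>
     (\<forall>i<length xs. {xs ! i, xs ! (Suc i mod length xs)} \<in> edges G)"

definition is_tree :: "'a graph \<Rightarrow> bool" where
  "is_tree G \<longleftrightarrow> simple_graph G \<and> graph_connected G \<and> \<not> (\<exists>xs. is_cycle G xs)"

section \<open>The irregularity and degree counts\<close>

text \<open>Edges are unordered pairs, so the contribution of an edge is written through the larger
  and the smaller of its two end-degrees; see \<open>edge_contribution\<close> below.\<close>

definition sigma :: "'a graph \<Rightarrow> int" where
  "sigma G =
     (\<Sum>e\<in>edges G. (Max ((\<lambda>u. int (deg G u)) ` e) - Min ((\<lambda>u. int (deg G u)) ` e))\<^sup>2)"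

lemma edge_contribution:
  "(Max ((\<lambda>u. int (deg G u)) ` {u, v}) - Min ((\<lambda>u. int (deg G u)) ` {u, v}))\<^sup>2
     = (int (deg G u) - int (deg G v))\<^sup>2"
  by (simp add: max_def min_def power2_commute)

definition n_deg :: "'a graph \<Rightarrow> nat \<Rightarrow> nat" where
  "n_deg G i = card {v \<in> verts G. deg G v = i}"

definition m_deg :: "'a graph \<Rightarrow> nat \<Rightarrow> nat \<Rightarrow> nat" where
  "m_deg G i j = card {e \<in> edges G. \<exists>u v. e = {u, v} \<and> deg G u = i \<and> deg G v = j}"

definition internal_leaf :: "'a graph \<Rightarrow> 'a \<Rightarrow> bool" where
  "internal_leaf G v \<longleftrightarrow>
     v \<in> verts G \<and> 2 \<le> deg G v \<and> card {u \<in> neighbors G v. 1 < deg G u} = 1"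

definition medium_verts :: "'a graph \<Rightarrow> 'a set" where
  "medium_verts G = {v \<in> verts G. deg G v \<in> {3..max_deg G - 1}}"

section \<open>The three families of trees\<close>

definition trees :: "nat \<Rightarrow> nat \<Rightarrow> 'a graph set" where
  "trees n \<Delta> = {T. is_tree T \<and> card (verts T) = n \<and> max_deg T = \<Delta>}"

definition fam1 :: "nat \<Rightarrow> nat \<Rightarrow> 'a graph set" where
  "fam1 n \<Delta> = {T \<in> trees n \<Delta>.
     (\<forall>v. internal_leaf T v \<longrightarrow> deg T v = \<Delta>) \<and>
     m_deg T 2 2 \<le> 2 \<and> m_deg T \<Delta> \<Delta> = 0 \<and>
     (\<Sum>i=3..\<Delta>-1. n_deg T i) \<le> 1 \<and>
     (m_deg T 2 2 = 0 \<longleftrightarrow>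
        (\<exists>a\<in>{3..\<Delta>-1}. (\<Sum>i=3..\<Delta>-1. n_deg T i) = n_deg T a \<and> n_deg T a = 1)) \<and>
     (m_deg T 2 2 = 0 \<longrightarrow>
        (\<forall>a\<in>{3..\<Delta>-1}. (\<Sum>i=3..\<Delta>-1. n_deg T i) = n_deg T a \<and> n_deg T a = 1
           \<longrightarrow> m_deg T a 2 = a))}"

definition fam2 :: "nat \<Rightarrow> nat \<Rightarrow> 'a graph set" where
  "fam2 n \<Delta> = {T \<in> trees n \<Delta>.
     (\<forall>v. internal_leaf T v \<longrightarrow> deg T v = \<Delta>) \<and>
     (\<forall>v\<in>verts T. deg T v \<in> {1, 2, \<Delta>}) \<and>
     m_deg T 2 2 = 0 \<and> m_deg T \<Delta> \<Delta> \<le> \<Delta> - 1}"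

definition fam3 :: "nat \<Rightarrow> nat \<Rightarrow> nat \<Rightarrow> 'a graph set" where
  "fam3 n \<Delta> j = {T \<in> trees n \<Delta>.
     (\<forall>v. internal_leaf T v \<longrightarrow> deg T v = \<Delta>) \<and>
     (\<exists>w. medium_verts T = {w} \<and> deg T w = j + 1 \<and>
          (\<forall>v\<in>verts T - {w}. deg T v \<in> {1, 2, \<Delta>}) \<and>
          card {u \<in> neighbors T w. deg T u = 2} = j \<and>
          card {u \<in> neighbors T w. deg T u = \<Delta>} = 1) \<and>
     m_deg T 2 2 = 0 \<and> m_deg T \<Delta> \<Delta> = 0}"

section \<open>The threshold\<close>

definition r_thr :: "nat \<Rightarrow> real" where
  "r_thr \<Delta> = 1/2 * (sqrt (5 * real \<Delta> ^ 2 - 32 * real \<Delta> + 44) - real \<Delta> + 4)"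

definition q_poly :: "nat \<Rightarrow> real poly" where
  "q_poly \<Delta> = [: - (real \<Delta> ^ 2 - 6 * real \<Delta> + 7), real \<Delta> - 4, 1 :]"

end

(* Since (x - y)^2 = (D - x)^2 + (D - y)^2 - 2 (D - x) (D - y), the irregularity of a graph with
   maximum degree D is the sum of d (D - d)^2 over the vertex degrees d, minus twice the sum of
   (D - d(u)) (D - d(v)) over the edges without an end of degree D. In each of the three families
   these exceptional edges are either those joining two vertices of degree 2 or those joining the
   medium vertex to a vertex of degree 2. Counting edge ends of degree D in a tree with
   k D + j edges gives D n_D = k D + j + m_DD - (number of exceptional edges); since the
   last two terms are small, n_D is k or k + 1, and the degree sum then fixes n_1 and n_2.
   The differences of the resulting values do not involve k; for j >= 2 one has
   sigma' - sigma'' = - (D - j) q(j). *)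

theory Submission
  imports Defs
begin

section \<open>Incidence and double counting in finite simple graphs\<close>

lemma simple_graph_edgeE:
  assumes "simple_graph G" "e \<in> edges G"
  obtains u v where "u \<in> verts G" "v \<in> verts G" "u \<noteq> v" "e = {u, v}"
  using assms unfolding simple_graph_def by blast

lemma finite_verts: "simple_graph G \<Longrightarrow> finite (verts G)"
  by (simp add: simple_graph_def)

lemma edge_subset_verts: "simple_graph G \<Longrightarrow> e \<in> edges G \<Longrightarrow> e \<subseteq> verts G"
  by (auto elim: simple_graph_edgeE)

lemma finite_edges: "simple_graph G \<Longrightarrow> finite (edges G)"
  by (rule finite_subset[of _ "Pow (verts G)"]) (auto dest: edge_subset_verts finite_verts)

lemma edge_in_neighbors:
  "simple_graph G \<Longrightarrow> {u, v} \<in> edges G \<Longrightarrow> v \<in> neighbors G u"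
  using edge_subset_verts[of G "{u, v}"] by (auto simp: neighbors_def)

lemma not_self_neighbor: "simple_graph G \<Longrightarrow> v \<notin> neighbors G v"
  by (auto simp: neighbors_def elim!: simple_graph_edgeE[of G "{v}"])

lemma finite_neighbors: "simple_graph G \<Longrightarrow> finite (neighbors G v)"
  by (auto simp: neighbors_def finite_verts)

lemma incident_edges_image:
  assumes "simple_graph G"
  shows "{e \<in> edges G. v \<in> e} = (\<lambda>u. {v, u}) ` neighbors G v"
proof (intro equalityI subsetI)
  fix e assume "e \<in> {e \<in> edges G. v \<in> e}"
  then have e: "e \<in> edges G" "v \<in> e" by auto
  obtain x y where "x \<in> verts G" "y \<in> verts G" "e = {x, y}"
    using simple_graph_edgeE[OF assms e(1)] .
  with e show "e \<in> (\<lambda>u. {v, u}) ` neighbors G v"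
    by (auto simp: neighbors_def insert_commute image_iff)
qed (auto simp: neighbors_def)

lemma inj_on_doubleton: "inj_on (\<lambda>u. {v, u}) A"
  by (auto simp: inj_on_def doubleton_eq_iff)

lemma card_incident_edges:
  "simple_graph G \<Longrightarrow> card {e \<in> edges G. v \<in> e} = deg G v"
  by (simp add: incident_edges_image card_image inj_on_doubleton deg_def)

text \<open>Both sides sum \<open>f v\<close> over all incident pairs of a vertex and an edge.
  Different weights give the degree sum, the count of edge ends of degree \<Delta>, and the sum of
  squares in \<open>sigma_eq\<close>.\<close>

lemma weighted_handshake:
  fixes f :: "'a \<Rightarrow> int"
  assumes G: "simple_graph G"
  shows "(\<Sum>v\<in>verts G. int (deg G v) * f v) = (\<Sum>e\<in>edges G. \<Sum>v\<in>e. f v)"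
proof -
  have "(\<Sum>v\<in>verts G. int (deg G v) * f v)
      = (\<Sum>v\<in>verts G. \<Sum>e | e \<in> edges G \<and> v \<in> e. f v)"
    by (simp add: card_incident_edges[OF G])
  also have "\<dots> = (\<Sum>e\<in>edges G. \<Sum>v | v \<in> verts G \<and> v \<in> e. f v)"
    by (rule sum.swap_restrict[OF finite_verts[OF G] finite_edges[OF G]])
  also have "\<dots> = (\<Sum>e\<in>edges G. \<Sum>v\<in>e. f v)"
    using edge_subset_verts[OF G] by (intro sum.cong refl) blast+
  finally show ?thesis .
qed

section \<open>Counting the edges of a tree\<close>

definition is_path :: "'a graph \<Rightarrow> 'a list \<Rightarrow> bool" where
  "is_path G xs \<longleftrightarrow> xs \<noteq> [] \<and> distinct xs \<and> set xs \<subseteq> verts G \<and>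
     (\<forall>i. Suc i < length xs \<longrightarrow> {xs ! i, xs ! Suc i} \<in> edges G)"

lemma is_path_Cons:
  assumes "is_path G xs" "y \<in> neighbors G (xs ! 0)" "y \<notin> set xs"
  shows "is_path G (y # xs)"
  using assms by (auto simp: is_path_def neighbors_def nth_Cons insert_commute split: nat.split)

text \<open>The first vertex of a path of maximal length has all its neighbors on the path; one of
  them that is not the second vertex closes a cycle.\<close>

lemma acyclic_obtains_deg_le_1:
  assumes G: "simple_graph G" "verts G \<noteq> {}" and acyclic: "\<nexists>xs. is_cycle G xs"
  obtains v where "v \<in> verts G" "deg G v \<le> 1"
proof -
  obtain v0 where "v0 \<in> verts G" using G(2) by blast
  then have "is_path G [v0]" by (simp add: is_path_def)
  moreover have "length xs \<le> card (verts G)" if "is_path G xs" for xs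
    using that card_mono[OF finite_verts[OF G(1)], of "set xs"]
    by (simp add: is_path_def distinct_card)
  ultimately obtain xs where xs: "is_path G xs"
    and longest: "\<And>ys. is_path G ys \<Longrightarrow> length ys \<le> length xs"
    using ex_has_greatest_nat[of "is_path G" "[v0]" length "Suc (card (verts G))"]
    by (auto simp: less_Suc_eq_le)
  \<comment> \<open>A neighbor off the path could be prepended, giving a longer path.\<close>
  have sub: "neighbors G (xs ! 0) \<subseteq> set xs"
    using longest is_path_Cons[OF xs] by fastforce
  have "deg G (xs ! 0) \<le> 1"
  proof (rule ccontr)
    assume "\<not> deg G (xs ! 0) \<le> 1"
    then have "\<not> neighbors G (xs ! 0) \<subseteq> {xs ! 1}"
      using card_mono[of "{xs ! 1}" "neighbors G (xs ! 0)"] by (auto simp: deg_def)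
    then obtain y where y: "y \<in> neighbors G (xs ! 0)" "y \<noteq> xs ! 1" by blast
    then obtain i where i: "i < length xs" "y = xs ! i"
      using sub by (metis in_set_conv_nth subsetD)
    have "i \<noteq> 0" "i \<noteq> 1"
      using y i not_self_neighbor[OF G(1)] by metis+
    then have i2: "2 \<le> i" by simp
    have "{xs ! i, xs ! 0} \<in> edges G"
      using y i by (simp add: neighbors_def insert_commute)
    \<comment> \<open>The cycle is the prefix that ends at \<open>y\<close>. Only for
      \<open>l = i\<close> does the index wrap around, to the edge from \<open>y\<close> back to the
      first vertex.\<close>
    then have "{take (Suc i) xs ! l, take (Suc i) xs ! (Suc l mod Suc i)} \<in> edges G"
      if "l \<le> i" for l
      using that i xs by (cases "l = i") (auto simp: is_path_def)
    moreover have "length (take (Suc i) xs) = Suc i" using i by simp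
    ultimately have "is_cycle G (take (Suc i) xs)"
      using i2 xs unfolding is_cycle_def is_path_def by (simp add: less_Suc_eq_le)
    with acyclic show False by blast
  qed
  moreover have "xs ! 0 \<in> verts G"
    using xs by (auto simp: is_path_def)
  ultimately show thesis using that by blast
qed

definition delete_vertex :: "'a \<Rightarrow> 'a graph \<Rightarrow> 'a graph" where
  "delete_vertex v G = \<lparr>verts = verts G - {v}, edges = {e \<in> edges G. v \<notin> e}\<rparr>"

lemma simple_graph_delete_vertex: "simple_graph G \<Longrightarrow> simple_graph (delete_vertex v G)"
  by (fastforce simp: simple_graph_def delete_vertex_def)

lemma is_cycle_delete_vertex: "is_cycle (delete_vertex v G) xs \<Longrightarrow> is_cycle G xs"
  by (auto simp: is_cycle_def delete_vertex_def)

text \<open>Induction on the number of vertices: deleting a vertex of degree at most 1 creates no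
  cycle and removes at most one edge. The case where no vertex remains is settled directly.\<close>

lemma acyclic_card_edges_less:
  assumes "simple_graph G" "verts G \<noteq> {}" "\<nexists>xs. is_cycle G xs"
  shows "card (edges G) < card (verts G)"
  using assms
proof (induction "card (verts G)" arbitrary: G rule: less_induct)
  case less
  note G = less.prems(1)
  obtain v where v: "v \<in> verts G" "deg G v \<le> 1"
    using acyclic_obtains_deg_le_1[OF less.prems] .
  let ?H = "delete_vertex v G"
  have vH: "Suc (card (verts ?H)) = card (verts G)"
    using v(1) finite_verts[OF G] by (simp add: delete_vertex_def card_Suc_Diff1 del: card_Diff_insert card_Diff_singleton)
  have "card (edges G) = card (edges ?H \<union> {e \<in> edges G. v \<in> e})"
    by (rule arg_cong[of _ _ card]) (auto simp: delete_vertex_def)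
  also have "\<dots> \<le> card (edges ?H) + 1"
    using card_Un_le[of "edges ?H" "{e \<in> edges G. v \<in> e}"] v(2) card_incident_edges[OF G, of v]
    by linarith
  finally have eH: "card (edges G) \<le> card (edges ?H) + 1" .
  show ?case
  proof (cases "verts ?H = {}")
    case True
    then have "verts G = {v}" using v by (auto simp: delete_vertex_def)
    then have "edges G = {}" using simple_graph_edgeE[OF G] by (metis all_not_in_conv singletonD)
    then show ?thesis using vH by simp
  next
    case False
    then have "card (edges ?H) < card (verts ?H)"
      using less.hyps[of ?H] vH simple_graph_delete_vertex[OF G] is_cycle_delete_vertex less.prems(3)
      by (metis lessI)
    then show ?thesis using eH vH by linarith
  qed
qed

lemma connected_closed_eq_verts:
  assumes "graph_connected G" "S \<subseteq> verts G" "S \<noteq> {}"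
    and closed: "\<And>u v. u \<in> S \<Longrightarrow> v \<in> verts G \<Longrightarrow> {u, v} \<in> edges G \<Longrightarrow> v \<in> S"
    and G: "simple_graph G"
  shows "S = verts G"
proof -
  obtain u where u: "u \<in> S" using assms(3) by blast
  have "v \<in> S" if "v \<in> verts G" for v
  proof -
    have "(u, v) \<in> {(x, y). {x, y} \<in> edges G}\<^sup>*"
      using assms(1,2) u that by (auto simp: graph_connected_def)
    then show ?thesis
    proof induction
      case (step y z)
      then show ?case using closed[of y z] edge_subset_verts[OF G, of "{y, z}"] by auto
    qed (rule u)
  qed
  with assms(2) show ?thesis by blast
qed

text \<open>A vertex set is grown from a single vertex. As long as it is proper, connectedness
  supplies an edge leaving it; adding the outer end of that edge puts at least one new edge inside
  the set.\<close>

lemma connected_card_verts_le: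
  assumes G: "simple_graph G" and conn: "graph_connected G"
  shows "card (verts G) \<le> Suc (card (edges G))"
proof -
  have "\<exists>S \<subseteq> verts G. card S = Suc i \<and> i \<le> card {e \<in> edges G. e \<subseteq> S}"
    if "i < card (verts G)" for i
    using that
  proof (induction i)
    case 0
    then obtain v where "v \<in> verts G" by fastforce
    then show ?case by (intro exI[of _ "{v}"]) simp
  next
    case (Suc i)
    then obtain S where S: "S \<subseteq> verts G" "card S = Suc i" "i \<le> card {e \<in> edges G. e \<subseteq> S}"
      by auto
    have "S \<noteq> verts G" "S \<noteq> {}" using S(2) Suc.prems by auto
    then obtain u v where uv: "u \<in> S" "v \<in> verts G" "{u, v} \<in> edges G" "v \<notin> S"
      using connected_closed_eq_verts[OF conn S(1) _ _ G] by blast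
    have fin: "finite S" "finite (edges G)"
      using finite_subset[OF S(1) finite_verts[OF G]] finite_edges[OF G] .
    have "Suc i \<le> card (insert {u, v} {e \<in> edges G. e \<subseteq> S})"
      using S(3) uv(4) fin by simp
    also have "\<dots> \<le> card {e \<in> edges G. e \<subseteq> insert v S}"
      using uv fin by (intro card_mono) auto
    finally show ?case
      using S uv fin by (intro exI[of _ "insert v S"]) simp
  qed
  from this[of "card (verts G) - 1"] obtain S
    where "card (verts G) - 1 \<le> card {e \<in> edges G. e \<subseteq> S}"
    using conn finite_verts[OF G] by (auto simp: graph_connected_def card_gt_0_iff)
  also have "\<dots> \<le> card (edges G)"
    by (intro card_mono finite_edges[OF G]) auto
  finally show ?thesis by simp
qed

lemma tree_card_verts: "is_tree T \<Longrightarrow> card (verts T) = Suc (card (edges T))"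
  using acyclic_card_edges_less[of T] connected_card_verts_le[of T]
  by (force simp: is_tree_def graph_connected_def)

section \<open>The irregularity in terms of degree counts\<close>

text \<open>The square sums at the two ends of each edge are regrouped by vertices. With \<Delta>
  chosen as the maximum degree, an edge with an end of that degree contributes 0 to the product
  sum.\<close>

lemma sigma_eq:
  fixes \<Delta> :: int
  assumes G: "simple_graph G"
  shows "sigma G = (\<Sum>v\<in>verts G. int (deg G v) * (\<Delta> - int (deg G v))\<^sup>2)
     - 2 * (\<Sum>e\<in>edges G. \<Prod>v\<in>e. \<Delta> - int (deg G v))"
proof -
  have "(Max ((\<lambda>u. int (deg G u)) ` e) - Min ((\<lambda>u. int (deg G u)) ` e))\<^sup>2
      = (\<Sum>v\<in>e. (\<Delta> - int (deg G v))\<^sup>2) - 2 * (\<Prod>v\<in>e. \<Delta> - int (deg G v))"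
    if e: "e \<in> edges G" for e
  proof -
    obtain u v where uv: "u \<noteq> v" "e = {u, v}" using simple_graph_edgeE[OF G e] .
    show ?thesis
      unfolding uv(2) edge_contribution using uv(1) by (simp add: power2_eq_square algebra_simps)
  qed
  then show ?thesis
    by (simp add: sigma_def weighted_handshake[OF G] sum_subtractf sum_distrib_left)
qed

text \<open>An edge with t ends of degree \<Delta>, where t is 0, 1 or 2, satisfies t = 1 + [t = 2]
  - [t = 0]; this is summed over all edges.\<close>

lemma max_degree_ends_count:
  assumes G: "simple_graph G"
  shows "int \<Delta> * int (n_deg G \<Delta>)
    = int (card (edges G)) + int (m_deg G \<Delta> \<Delta>) - int (card {e \<in> edges G. \<forall>v\<in>e. deg G v \<noteq> \<Delta>})"
proof -
  have "int \<Delta> * int (n_deg G \<Delta>) = (\<Sum>v\<in>verts G. int (deg G v) * (if deg G v = \<Delta> then 1 else 0))"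
    unfolding n_deg_def
    by (simp add: if_distrib[of "\<lambda>x. _ * x"] sum.If_cases finite_verts[OF G] Int_def cong: if_cong)
  also have "\<dots> = (\<Sum>e\<in>edges G. \<Sum>v\<in>e. if deg G v = \<Delta> then 1 else 0)"
    by (rule weighted_handshake[OF G])
  also have "\<dots> = (\<Sum>e\<in>edges G. 1
      + (if \<exists>u v. e = {u, v} \<and> deg G u = \<Delta> \<and> deg G v = \<Delta> then 1 else 0)
      - (if \<forall>v\<in>e. deg G v \<noteq> \<Delta> then 1 else 0))"
  proof (intro sum.cong refl)
    fix e assume e: "e \<in> edges G"
    obtain u v where uv: "u \<noteq> v" "e = {u, v}" using simple_graph_edgeE[OF G e] .
    have "(\<exists>x y. e = {x, y} \<and> deg G x = \<Delta> \<and> deg G y = \<Delta>) \<longleftrightarrow> deg G u = \<Delta> \<and> deg G v = \<Delta>"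
      using uv by (auto simp: doubleton_eq_iff)
    then show "(\<Sum>v\<in>e. if deg G v = \<Delta> then 1 else 0) = 1
      + (if \<exists>u v. e = {u, v} \<and> deg G u = \<Delta> \<and> deg G v = \<Delta> then 1 else 0)
      - (if \<forall>v\<in>e. deg G v \<noteq> \<Delta> then 1 else (0::int))"
      using uv by simp
  qed
  also have "\<dots> = int (card (edges G)) + int (m_deg G \<Delta> \<Delta>)
      - int (card {e \<in> edges G. \<forall>v\<in>e. deg G v \<noteq> \<Delta>})"
    by (simp add: sum.distrib sum_subtractf m_deg_def sum.If_cases finite_edges[OF G] Int_def)
  finally show ?thesis .
qed


text \<open>The bounds on \<open>a\<close> keep 1, 2, \<open>a\<close> and \<Delta> distinct, so
  exactly one of four indicators applies at each vertex. \<open>W\<close> is the set of medium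
  vertices, empty or a singleton in the applications.\<close>

lemma sum_over_degrees:
  fixes f :: "nat \<Rightarrow> int"
  assumes G: "simple_graph G" and W: "W \<subseteq> verts G" "\<And>v. v \<in> W \<Longrightarrow> deg G v = a"
    and other: "\<And>v. v \<in> verts G - W \<Longrightarrow> deg G v \<in> {1, 2, \<Delta>}"
    and a: "3 \<le> a" "a < \<Delta>"
  shows "(\<Sum>v\<in>verts G. f (deg G v)) = int (n_deg G 1) * f 1 + int (n_deg G 2) * f 2
    + int (n_deg G \<Delta>) * f \<Delta> + int (card W) * f a"
proof -
  have "(\<Sum>v\<in>verts G. f (deg G v)) = (\<Sum>v\<in>verts G. (if deg G v = 1 then f 1 else 0)
      + (if deg G v = 2 then f 2 else 0) + (if deg G v = \<Delta> then f \<Delta> else 0)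
      + (if v \<in> W then f a else 0))"
    using W other a by (intro sum.cong refl) fastforce
  also have "\<dots> = int (n_deg G 1) * f 1 + int (n_deg G 2) * f 2 + int (n_deg G \<Delta>) * f \<Delta>
      + int (card W) * f a"
    using W(1)
    by (simp add: sum.distrib n_deg_def sum.If_cases finite_verts[OF G] Int_absorb1 Collect_conj_eq)
  finally show ?thesis .
qed

lemma treesD:
  assumes "T \<in> trees n \<Delta>"
  shows "is_tree T" "simple_graph T" "graph_connected T" "card (verts T) = n" "max_deg T = \<Delta>"
  using assms by (auto simp: trees_def is_tree_def)

text \<open>The vertex count and the degree sum are two linear equations for the numbers of vertices
  of degrees 1 and 2. Their solution is substituted into \<open>sigma_eq\<close>, where every
  exceptional edge contributes the same product \<open>c\<close>.\<close>

lemma tree_counts: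
  assumes T: "T \<in> trees (k * \<Delta> + 1 + j) \<Delta>"
    and W: "W \<subseteq> verts T" "\<And>v. v \<in> W \<Longrightarrow> deg T v = a"
    and other: "\<And>v. v \<in> verts T - W \<Longrightarrow> deg T v \<in> {1, 2, \<Delta>}"
    and a: "3 \<le> a" "a < \<Delta>"
    and X: "X = {e \<in> edges T. \<forall>v\<in>e. deg T v \<noteq> \<Delta>}"
    and c: "\<And>e. e \<in> X \<Longrightarrow> (\<Prod>v\<in>e. int \<Delta> - int (deg T v)) = c"
  defines "D \<equiv> int (n_deg T \<Delta>)" and "d \<equiv> int \<Delta>" and "p \<equiv> int (card W)"
  shows "d * D = int k * d + int j + int (m_deg T \<Delta> \<Delta>) - int (card X)"
    and "sigma T = (2 + (d - 2) * D + p * (int a - 2)) * (d - 1)\<^sup>2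
      + 2 * (int k * d + int j - 1 - (d - 1) * D - p * (int a - 1)) * (d - 2)\<^sup>2
      + p * int a * (d - int a)\<^sup>2 - 2 * c * int (card X)"
proof -
  note G = treesD(2)[OF T]
  note degsum = sum_over_degrees[OF G W other a]
  have E: "int (card (edges T)) = int k * d + int j"
    using tree_card_verts[OF treesD(1)[OF T]] treesD(4)[OF T]
    by (simp add: d_def flip: of_nat_mult of_nat_add)
  show "d * D = int k * d + int j + int (m_deg T \<Delta> \<Delta>) - int (card X)"
    using max_degree_ends_count[OF G, of \<Delta>] E X by (simp add: d_def D_def)
  have V: "int k * d + int j + 1 = int (n_deg T 1) + int (n_deg T 2) + D + p"
    using degsum[of "\<lambda>_. 1"] treesD(4)[OF T] by (simp add: d_def D_def p_def)
  have "(\<Sum>v\<in>e. 1 :: int) = 2" if "e \<in> edges T" for e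
    by (rule simple_graph_edgeE[OF G that]) simp
  then have "(\<Sum>v\<in>verts T. int (deg T v)) = 2 * (int k * d + int j)"
    using weighted_handshake[OF G, of "\<lambda>_. 1"] E by simp
  then have H: "2 * (int k * d + int j)
      = int (n_deg T 1) + 2 * int (n_deg T 2) + d * D + p * int a"
    using degsum[of int] by (simp add: d_def D_def p_def)
  \<comment> \<open>An edge outside \<open>X\<close> has an end of degree \<Delta>, hence a zero
    factor.\<close>
  have "(\<Prod>v\<in>e. d - int (deg T v)) = (if e \<in> X then c else 0)" if e: "e \<in> edges T" for e
  proof (cases "e \<in> X")
    case False
    obtain u v where "u \<noteq> v" "e = {u, v}" using simple_graph_edgeE[OF G e] .
    with e False show ?thesis by (auto simp: X d_def)
  qed (simp add: c d_def)
  then have "(\<Sum>e\<in>edges T. \<Prod>v\<in>e. d - int (deg T v)) = (\<Sum>e\<in>edges T. if e \<in> X then c else 0)"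
    by (intro sum.cong refl)
  also have "\<dots> = int (card X) * c"
    using finite_edges[OF G] by (simp add: sum.If_cases X Int_def)
  finally have P: "(\<Sum>e\<in>edges T. \<Prod>v\<in>e. d - int (deg T v)) = int (card X) * c" .
  have S: "sigma T = int (n_deg T 1) * (d - 1)\<^sup>2 + int (n_deg T 2) * (2 * (d - 2)\<^sup>2)
      + p * (int a * (d - int a)\<^sup>2) - 2 * (int (card X) * c)"
    using sigma_eq[OF G, of d] degsum[of "\<lambda>i. int i * (d - int i)\<^sup>2"] P
    by (simp add: d_def p_def)
  \<comment> \<open>This is \<open>H\<close> minus \<open>V\<close>; the formula for degree 1 below
    is twice \<open>V\<close> minus \<open>H\<close>.\<close>
  have n2: "int (n_deg T 2) = int k * d + int j - 1 - (d - 1) * D - p * (int a - 1)"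
    using V H by (simp add: algebra_simps)
  have n1: "int (n_deg T 1) = 2 + (d - 2) * D + p * (int a - 2)"
    using V H by (simp add: algebra_simps)
  show "sigma T = (2 + (d - 2) * D + p * (int a - 2)) * (d - 1)\<^sup>2
      + 2 * (int k * d + int j - 1 - (d - 1) * D - p * (int a - 1)) * (d - 2)\<^sup>2
      + p * int a * (d - int a)\<^sup>2 - 2 * c * int (card X)"
    unfolding S n1 n2 by simp
qed

section \<open>Edges without an end of maximum degree\<close>

text \<open>If all neighbors of \<open>v\<close> were leaves, \<open>v\<close> and its neighbors
  would be closed under adjacency and so form the whole tree. No vertex could then have degree
  \<Delta>.\<close>

lemma nonleaf_neighbor:
  assumes T: "T \<in> trees n \<Delta>" "2 \<le> \<Delta>" and v: "v \<in> verts T" "deg T v \<noteq> \<Delta>"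
  obtains u where "u \<in> neighbors T v" "1 < deg T u"
proof (rule ccontr)
  note G = treesD(2)[OF T(1)]
  assume "\<not> thesis"
  then have leaf: "deg T u \<le> 1" if "u \<in> neighbors T v" for u
    using that \<open>\<And>u. _ \<Longrightarrow> _ \<Longrightarrow> thesis\<close> by fastforce
  have "insert v (neighbors T v) = verts T"
  proof (rule connected_closed_eq_verts[OF treesD(3)[OF T(1)] _ _ _ G])
    fix x y assume xy: "x \<in> insert v (neighbors T v)" "{x, y} \<in> edges T"
    have yx: "y \<in> neighbors T x" using edge_in_neighbors[OF G xy(2)] .
    show "y \<in> insert v (neighbors T v)"
    proof (cases "x = v")
      case False
      then have x: "x \<in> neighbors T v" using xy by blast
      then have "v \<in> neighbors T x" using v by (simp add: neighbors_def insert_commute)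
      with leaf[OF x] yx have "y = v"
        using finite_neighbors[OF G] by (metis One_nat_def card_le_Suc0_iff_eq deg_def)
      then show ?thesis by simp
    qed (use yx in simp)
  qed (use v in \<open>auto simp: neighbors_def\<close>)
  moreover have "max_deg T \<in> deg T ` verts T"
    unfolding max_deg_def using finite_verts[OF G] v by (intro Max_in) auto
  ultimately obtain z where "z \<in> insert v (neighbors T v)" "deg T z = \<Delta>"
    using treesD(5)[OF T(1)] by auto
  then show False using v T(2) leaf[of z] by auto
qed

lemma deg_pos:
  assumes T: "T \<in> trees n \<Delta>" "2 \<le> \<Delta>" and v: "v \<in> verts T"
  shows "1 \<le> deg T v"
proof (cases "deg T v = \<Delta>")
  case False
  from nonleaf_neighbor[OF T v False] show ?thesis
    using finite_neighbors[OF treesD(2)[OF T(1)], of v]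
    by (metis One_nat_def Suc_leI card_gt_0_iff deg_def empty_iff)
qed (use T in simp)

lemma deg_le_max: "T \<in> trees n \<Delta> \<Longrightarrow> v \<in> verts T \<Longrightarrow> deg T v \<le> \<Delta>"
  using finite_verts[of T] by (auto simp: trees_def is_tree_def max_deg_def)

text \<open>Besides the leaf \<open>u\<close>, \<open>v\<close> has a non-leaf neighbor. If its
  degree were 2, that would be its only non-leaf neighbor, making \<open>v\<close> an internal leaf
  of degree other than \<Delta>.\<close>

lemma pendant_neighbor_deg:
  assumes T: "T \<in> trees n \<Delta>" "2 \<le> \<Delta>"
    and il: "\<forall>v. internal_leaf T v \<longrightarrow> deg T v = \<Delta>"
    and uv: "{u, v} \<in> edges T" "deg T u = 1" "deg T v \<noteq> \<Delta>"
  shows "3 \<le> deg T v"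
proof -
  note G = treesD(2)[OF T(1)]
  have v: "v \<in> verts T" and u: "u \<in> neighbors T v"
    using edge_subset_verts[OF G uv(1)] uv(1) by (auto simp: neighbors_def insert_commute)
  obtain x where x: "x \<in> neighbors T v" "1 < deg T x"
    using nonleaf_neighbor[OF T v uv(3)] .
  have ux: "u \<noteq> x" using uv x by auto
  have ge2: "2 \<le> deg T v"
    using card_mono[OF finite_neighbors[OF G], of "{u, x}" v] u x ux by (simp add: deg_def)
  have "deg T v \<noteq> 2"
  proof
    assume d2: "deg T v = 2"
    have "{u, x} = neighbors T v"
      using d2 u x ux by (intro card_subset_eq finite_neighbors[OF G]) (auto simp: deg_def)
    then have "{y \<in> neighbors T v. 1 < deg T y} = {x}"
      using uv(2) x by (force simp: set_eq_iff)
    then have "internal_leaf T v" using v d2 by (simp add: internal_leaf_def)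
    with il uv(3) show False by blast
  qed
  with ge2 show ?thesis by simp
qed

lemma m_deg_eq_0D:
  assumes "simple_graph G" "m_deg G i i' = 0" "{u, v} \<in> edges G" "deg G u = i" "deg G v = i'"
  shows False
  using assms finite_edges[OF assms(1)] by (auto simp: m_deg_def)

text \<open>By \<open>pendant_neighbor_deg\<close> the neighbor of a leaf has degree at least 3,
  which here means \<Delta>. Both ends of an exceptional edge therefore have degree 2.\<close>

lemma edges_without_max_deg_end:
  assumes T: "T \<in> trees n \<Delta>" "3 \<le> \<Delta>"
    and il: "\<forall>v. internal_leaf T v \<longrightarrow> deg T v = \<Delta>"
    and degs: "\<forall>v\<in>verts T. deg T v \<in> {1, 2, \<Delta>}"
  shows "{e \<in> edges T. \<forall>v\<in>e. deg T v \<noteq> \<Delta>}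
    = {e \<in> edges T. \<exists>u v. e = {u, v} \<and> deg T u = 2 \<and> deg T v = 2}"
proof (intro Collect_cong conj_cong refl)
  fix e assume e: "e \<in> edges T"
  note G = treesD(2)[OF T(1)]
  obtain u v where uv: "u \<in> verts T" "v \<in> verts T" "e = {u, v}"
    using simple_graph_edgeE[OF G e] .
  have pend: "deg T x \<noteq> 1" if "{x, y} = e" "deg T y \<noteq> \<Delta>" for x y
    using pendant_neighbor_deg[OF T(1) _ il, of x y] that e degs T(2) edge_subset_verts[OF G e]
    by force
  have "deg T u = 2 \<and> deg T v = 2" if "deg T u \<noteq> \<Delta>" "deg T v \<noteq> \<Delta>"
    using pend[of u v] pend[of v u] that uv degs by (auto simp: insert_commute)
  then show "(\<forall>v\<in>e. deg T v \<noteq> \<Delta>) \<longleftrightarrow> (\<exists>u v. e = {u, v} \<and> deg T u = 2 \<and> deg T v = 2)"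
    using uv T(2) by (auto simp: doubleton_eq_iff)
qed

text \<open>An exceptional edge avoiding \<open>w\<close> would join two vertices of degree 2, as in
  the case without a medium vertex, and \<open>m22\<close> forbids this.\<close>

lemma edges_without_max_deg_end_medium:
  assumes T: "T \<in> trees n \<Delta>" "3 \<le> \<Delta>"
    and il: "\<forall>v. internal_leaf T v \<longrightarrow> deg T v = \<Delta>"
    and w: "w \<in> verts T" "deg T w \<noteq> \<Delta>"
    and degs: "\<forall>v\<in>verts T - {w}. deg T v \<in> {1, 2, \<Delta>}"
    and m22: "m_deg T 2 2 = 0"
    and nb: "\<forall>u\<in>neighbors T w. deg T u \<in> {2, \<Delta>}"
  shows "{e \<in> edges T. \<forall>v\<in>e. deg T v \<noteq> \<Delta>} = (\<lambda>u. {w, u}) ` {u \<in> neighbors T w. deg T u = 2}"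
proof (intro equalityI subsetI)
  note G = treesD(2)[OF T(1)]
  fix e assume "e \<in> {e \<in> edges T. \<forall>v\<in>e. deg T v \<noteq> \<Delta>}"
  then have e: "e \<in> edges T" and nD: "\<forall>v\<in>e. deg T v \<noteq> \<Delta>" by auto
  obtain u v where uv: "u \<in> verts T" "v \<in> verts T" "e = {u, v}"
    using simple_graph_edgeE[OF G e] .
  have "w \<in> e"
  proof (rule ccontr)
    assume "w \<notin> e"
    then have d: "deg T u \<in> {1, 2}" "deg T v \<in> {1, 2}" using uv degs nD by auto
    have "deg T u \<noteq> 1" "deg T v \<noteq> 1"
      using pendant_neighbor_deg[OF T(1) _ il, of u v] pendant_neighbor_deg[OF T(1) _ il, of v u]
        d uv e nD T(2) by (auto simp: insert_commute)
    with d have "deg T u = 2" "deg T v = 2" by auto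
    then show False using m_deg_eq_0D[OF G m22] e uv by blast
  qed
  then have "e \<in> (\<lambda>u. {w, u}) ` neighbors T w"
    using incident_edges_image[OF G] e by blast
  then show "e \<in> (\<lambda>u. {w, u}) ` {u \<in> neighbors T w. deg T u = 2}"
    using nb nD by auto
next
  fix e assume "e \<in> (\<lambda>u. {w, u}) ` {u \<in> neighbors T w. deg T u = 2}"
  then show "e \<in> {e \<in> edges T. \<forall>v\<in>e. deg T v \<noteq> \<Delta>}"
    using w(2) T(2) by (auto simp: neighbors_def)
qed

section \<open>The common value of the irregularity in each family\<close>

text \<open>The remainder \<open>z\<close> is a multiple of \<open>d\<close> that is smaller than
  \<open>d\<close> in absolute value. This reads the number of vertices of degree \<Delta> off
  \<open>tree_counts\<close>.\<close>

lemma dvd_abs_less_eq_0: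
  fixes d x y z :: int
  assumes "d * x = y * d + z" "\<bar>z\<bar> < d"
  shows "z = 0" "x = y"
proof -
  have z: "z = d * (x - y)" using assms(1) by (simp add: algebra_simps)
  then show "z = 0"
    using assms(2) by (metis dvd_imp_le_int dvd_triv_left abs_ge_self not_le order_le_less_trans)
  with z assms show "x = y" by auto
qed

lemma card_medium:
  assumes "simple_graph G"
  shows "(\<Sum>i=3..\<Delta>-1. n_deg G i) = card {v \<in> verts G. deg G v \<in> {3..\<Delta>-1}}"
proof -
  have "(\<Sum>i=3..\<Delta>-1. n_deg G i) = card (\<Union>i\<in>{3..\<Delta>-1}. {v \<in> verts G. deg G v = i})"
    unfolding n_deg_def using finite_verts[OF assms] by (subst card_UN_disjoint) auto
  also have "(\<Union>i\<in>{3..\<Delta>-1}. {v \<in> verts G. deg G v = i}) = {v \<in> verts G. deg G v \<in> {3..\<Delta>-1}}"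
    by auto
  finally show ?thesis .
qed

text \<open>This is the quantity B shared by the three values; it factors as k (d - 2) (d^2 -
  3).\<close>

definition base_sigma :: "int \<Rightarrow> int \<Rightarrow> int" where
  "base_sigma d k = d ^ 3 * k - 2 * d\<^sup>2 * k - 3 * d * k + 6 * k"

context
  fixes k j \<Delta> :: nat
  assumes \<Delta>: "6 \<le> \<Delta>" and j: "1 \<le> j" "j \<le> \<Delta> - 1"
begin

lemma sigma_bidegreed:
  assumes T: "T \<in> trees (k * \<Delta> + 1 + j) \<Delta>"
    and il: "\<forall>v. internal_leaf T v \<longrightarrow> deg T v = \<Delta>"
    and degs: "\<forall>v\<in>verts T. deg T v \<in> {1, 2, \<Delta>}"
  defines "D \<equiv> int (n_deg T \<Delta>)" and "d \<equiv> int \<Delta>"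
  shows "d * D = int k * d + (int j + int (m_deg T \<Delta> \<Delta>) - int (m_deg T 2 2))"
    and "sigma T = (2 + (d - 2) * D) * (d - 1)\<^sup>2
      + 2 * (int k * d + int j - 1 - (d - 1) * D - int (m_deg T 2 2)) * (d - 2)\<^sup>2"
proof -
  note G = treesD(2)[OF T]
  have prod: "(\<Prod>v\<in>e. int \<Delta> - int (deg T v)) = (d - 2)\<^sup>2"
    if "e \<in> {e \<in> edges T. \<exists>u v. e = {u, v} \<and> deg T u = 2 \<and> deg T v = 2}" for e
  proof -
    from that have e: "e \<in> edges T" by blast
    obtain u v where "u \<noteq> v" "e = {u, v}" using simple_graph_edgeE[OF G e] .
    then show ?thesis using that by (auto simp: doubleton_eq_iff d_def power2_eq_square)
  qed
  \<comment> \<open>The value 3 is a placeholder for the degree \<open>a\<close>, since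
    \<open>W\<close> is empty.\<close>
  have \<Delta>3: "3 \<le> \<Delta>" "(3::nat) \<le> 3" "3 < \<Delta>" using \<Delta> by auto
  note X = edges_without_max_deg_end[OF T \<Delta>3(1) il degs, symmetric]
  have c: "card {e \<in> edges T. \<exists>u v. e = {u, v} \<and> deg T u = 2 \<and> deg T v = 2} = m_deg T 2 2"
    by (simp add: m_deg_def)
  note counts = tree_counts[where W = "{}", OF T _ _ _ \<Delta>3(2,3) X prod, unfolded c]
  show "d * D = int k * d + (int j + int (m_deg T \<Delta> \<Delta>) - int (m_deg T 2 2))"
    using counts(1) degs by (simp add: d_def D_def)
  show "sigma T = (2 + (d - 2) * D) * (d - 1)\<^sup>2
      + 2 * (int k * d + int j - 1 - (d - 1) * D - int (m_deg T 2 2)) * (d - 2)\<^sup>2"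
    using counts(2) degs by (simp add: d_def D_def algebra_simps)
qed

text \<open>The exceptional edges are the \<open>x\<close> edges from \<open>w\<close> to vertices
  of degree 2. Divisibility of j - x by \<Delta> forces x = j and exactly k vertices of degree
  \<Delta>. It serves the first family with a = x and the third with a = x + 1.\<close>

lemma sigma_one_medium:
  assumes T: "T \<in> trees (k * \<Delta> + 1 + j) \<Delta>"
    and il: "\<forall>v. internal_leaf T v \<longrightarrow> deg T v = \<Delta>"
    and w: "w \<in> verts T" "deg T w = a" "3 \<le> a" "a < \<Delta>"
    and degs: "\<forall>v\<in>verts T - {w}. deg T v \<in> {1, 2, \<Delta>}"
    and m22: "m_deg T 2 2 = 0"
    and nb: "\<forall>u\<in>neighbors T w. deg T u \<in> {2, \<Delta>}"
    and x: "x = card {u \<in> neighbors T w. deg T u = 2}"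
    and mDD: "m_deg T \<Delta> \<Delta> = 0"
    and small: "\<bar>int j - int x\<bar> < int \<Delta>"
  defines "d \<equiv> int \<Delta>"
  shows "x = j"
    and "sigma T = ((d - 2) * int k + int a) * (d - 1)\<^sup>2
      + 2 * (int j + int k - int a) * (d - 2)\<^sup>2
      + int a * (d - int a)\<^sup>2 - 2 * (d - 2) * (d - int a) * int j"
proof -
  note G = treesD(2)[OF T]
  have aD: "deg T w \<noteq> \<Delta>" using w by simp
  have \<Delta>3: "3 \<le> \<Delta>" using \<Delta> by simp
  note X = edges_without_max_deg_end_medium[OF T \<Delta>3 il w(1) aD degs m22 nb, symmetric]
  have prod: "(\<Prod>v\<in>e. int \<Delta> - int (deg T v)) = (d - 2) * (d - int a)"
    if "e \<in> (\<lambda>u. {w, u}) ` {u \<in> neighbors T w. deg T u = 2}" for e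
  proof -
    from that obtain u where "u \<in> neighbors T w" "deg T u = 2" "e = {w, u}" by blast
    moreover from this have "w \<noteq> u" using not_self_neighbor[OF G] by blast
    ultimately show ?thesis using w(2) by (simp add: d_def)
  qed
  have c: "card ((\<lambda>u. {w, u}) ` {u \<in> neighbors T w. deg T u = 2}) = x"
    by (simp add: x card_image inj_on_doubleton)
  have W: "{w} \<subseteq> verts T" "\<And>v. v \<in> {w} \<Longrightarrow> deg T v = a"
    and other: "\<And>v. v \<in> verts T - {w} \<Longrightarrow> deg T v \<in> {1, 2, \<Delta>}"
    using w degs by auto
  note counts = tree_counts[OF T W other w(3,4) X prod, unfolded c]
  have "int \<Delta> * int (n_deg T \<Delta>) = int k * int \<Delta> + (int j - int x)"
    using counts(1) mDD by simp
  note D = dvd_abs_less_eq_0[OF this small]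
  show xj: "x = j" using D(1) by simp
  show "sigma T = ((d - 2) * int k + int a) * (d - 1)\<^sup>2
      + 2 * (int j + int k - int a) * (d - 2)\<^sup>2
      + int a * (d - int a)\<^sup>2 - 2 * (d - 2) * (d - int a) * int j"
    using counts(2) D(2) xj by (simp add: d_def algebra_simps)
qed

text \<open>If m_22 = 0, the medium vertex has only neighbors of degree 2, so its degree equals j
  and j is at least 3. Otherwise there is no medium vertex and m_22 = j, so j is at most 2. This is
  the case split in the formula.\<close>

lemma sigma_fam1:
  assumes "T \<in> fam1 (k * \<Delta> + 1 + j) \<Delta>"
  shows "sigma T = base_sigma (int \<Delta>) (int k) + (if j \<le> 2 then 4 * int \<Delta> - 6
    else 2 * int \<Delta> * int j + int j ^ 3 - 4 * (int j)\<^sup>2 + int j)"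
proof -
  from assms have T: "T \<in> trees (k * \<Delta> + 1 + j) \<Delta>"
    and il: "\<forall>v. internal_leaf T v \<longrightarrow> deg T v = \<Delta>"
    and m22: "m_deg T 2 2 \<le> 2" and mDD: "m_deg T \<Delta> \<Delta> = 0"
    and le1: "(\<Sum>i=3..\<Delta>-1. n_deg T i) \<le> 1"
    and iff: "m_deg T 2 2 = 0 \<longleftrightarrow>
        (\<exists>a\<in>{3..\<Delta>-1}. (\<Sum>i=3..\<Delta>-1. n_deg T i) = n_deg T a \<and> n_deg T a = 1)"
    and ma2: "m_deg T 2 2 = 0 \<longrightarrow>
        (\<forall>a\<in>{3..\<Delta>-1}. (\<Sum>i=3..\<Delta>-1. n_deg T i) = n_deg T a \<and> n_deg T a = 1
           \<longrightarrow> m_deg T a 2 = a)"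
    unfolding fam1_def by blast+
  note G = treesD(2)[OF T]
  have degs: "deg T v \<in> {1, 2, \<Delta>} \<or> deg T v \<in> {3..\<Delta>-1}" if "v \<in> verts T" for v
    using deg_pos[OF T _ that] deg_le_max[OF T that] \<Delta> by auto
  show ?thesis
  proof (cases "m_deg T 2 2 = 0")
    case True
    then obtain a where a: "3 \<le> a" "a < \<Delta>" and one: "(\<Sum>i=3..\<Delta>-1. n_deg T i) = 1" "n_deg T a = 1"
      and m: "m_deg T a 2 = a"
      using iff ma2 \<Delta> by fastforce
    from one(2) obtain w where w: "{v \<in> verts T. deg T v = a} = {w}"
      by (auto simp: n_deg_def card_1_singleton_iff)
    then have wV: "w \<in> verts T" "deg T w = a" by auto
    have "card {v \<in> verts T. deg T v \<in> {3..\<Delta>-1}} = 1"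
      unfolding card_medium[OF G, symmetric] by (rule one(1))
    then obtain w' where w': "{v \<in> verts T. deg T v \<in> {3..\<Delta>-1}} = {w'}"
      by (rule card_1_singletonE)
    moreover have "w \<in> {v \<in> verts T. deg T v \<in> {3..\<Delta>-1}}"
      using wV a by simp
    ultimately have "{v \<in> verts T. deg T v \<in> {3..\<Delta>-1}} = {w}"
      by (simp only: singleton_iff)
    then have other: "\<forall>v\<in>verts T - {w}. deg T v \<in> {1, 2, \<Delta>}"
      using degs by blast
    \<comment> \<open>All edges counted by m_a2 start at \<open>w\<close>, so m_a2 = a makes every
      neighbor of \<open>w\<close> have degree 2.\<close>
    have "{e \<in> edges T. \<exists>u v. e = {u, v} \<and> deg T u = a \<and> deg T v = 2}
        \<subseteq> (\<lambda>u. {w, u}) ` {u \<in> neighbors T w. deg T u = 2}"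
    proof safe
      fix u v assume uv: "{u, v} \<in> edges T" "deg T v = 2" "a = deg T u"
      then have "u = w" using w edge_subset_verts[OF G uv(1)] by blast
      then show "{u, v} \<in> (\<lambda>x. {w, x}) ` {x \<in> neighbors T w. deg T x = 2}"
        using uv edge_in_neighbors[OF G uv(1)] by blast
    qed
    from surj_card_le[OF _ this] have "a \<le> card {u \<in> neighbors T w. deg T u = 2}"
      using m finite_neighbors[OF G, of w] by (simp add: m_deg_def)
    then have nb2: "{u \<in> neighbors T w. deg T u = 2} = neighbors T w"
      using wV(2) by (intro card_seteq finite_neighbors[OF G]) (auto simp: deg_def)
    then have nb: "\<forall>u\<in>neighbors T w. deg T u \<in> {2, \<Delta>}" by blast
    have x: "a = card {u \<in> neighbors T w. deg T u = 2}"
      using wV(2) nb2 by (simp add: deg_def)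
    have small: "\<bar>int j - int a\<bar> < int \<Delta>" using j a by linarith
    note s = sigma_one_medium[OF T il wV a other True nb x mDD small]
    then show ?thesis using a
      by (simp add: base_sigma_def algebra_simps power2_eq_square power3_eq_cube)
  next
    case False
    have "(\<Sum>i=3..\<Delta>-1. n_deg T i) \<noteq> 1"
    proof
      assume sum1: "(\<Sum>i=3..\<Delta>-1. n_deg T i) = 1"
      then obtain a where "a \<in> {3..\<Delta>-1}" "n_deg T a = 1"
        by (auto simp: sum_eq_Suc0_iff)
      with sum1 show False using iff False by (metis (no_types, lifting))
    qed
    then have "card {v \<in> verts T. deg T v \<in> {3..\<Delta>-1}} = 0"
      using le1 card_medium[OF G] by (metis One_nat_def le_Suc_eq le_zero_eq)
    then have "{v \<in> verts T. deg T v \<in> {3..\<Delta>-1}} = {}"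
      using finite_verts[OF G] by simp
    then have other: "\<forall>v\<in>verts T. deg T v \<in> {1, 2, \<Delta>}"
      using degs by blast
    note s = sigma_bidegreed[OF T il other]
    have small: "\<bar>int j - int (m_deg T 2 2)\<bar> < int \<Delta>" using j m22 \<Delta> by linarith
    have "int \<Delta> * int (n_deg T \<Delta>) = int k * int \<Delta> + (int j - int (m_deg T 2 2))"
      using s(1) mDD by simp
    note D = dvd_abs_less_eq_0[OF this small]
    show ?thesis using s(2) D m22
      by (simp add: base_sigma_def algebra_simps power2_eq_square power3_eq_cube)
  qed
qed

lemma sigma_fam2:
  assumes "T \<in> fam2 (k * \<Delta> + 1 + j) \<Delta>"
  shows "sigma T = base_sigma (int \<Delta>) (int k) - int \<Delta> ^ 3 + 2 * (int \<Delta>)\<^sup>2 * int j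
    + 6 * (int \<Delta>)\<^sup>2 - 8 * int \<Delta> * int j - 7 * int \<Delta> + 8 * int j"
proof -
  from assms have T: "T \<in> trees (k * \<Delta> + 1 + j) \<Delta>"
    and il: "\<forall>v. internal_leaf T v \<longrightarrow> deg T v = \<Delta>"
    and degs: "\<forall>v\<in>verts T. deg T v \<in> {1, 2, \<Delta>}"
    and m22: "m_deg T 2 2 = 0" and mDD: "m_deg T \<Delta> \<Delta> \<le> \<Delta> - 1"
    by (auto simp: fam2_def)
  note s = sigma_bidegreed[OF T il degs]
  \<comment> \<open>Since j plus m_DD lies between 1 and 2 \<Delta> - 2, its only possible multiple
    of \<Delta> is \<Delta> itself; hence there are k + 1 vertices of degree \<Delta>.\<close>
  have small: "\<bar>int j + int (m_deg T \<Delta> \<Delta>) - int \<Delta>\<bar> < int \<Delta>" using j mDD \<Delta> by linarith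
  have "int \<Delta> * int (n_deg T \<Delta>) = (int k + 1) * int \<Delta> + (int j + int (m_deg T \<Delta> \<Delta>) - int \<Delta>)"
    using s(1) m22 by (simp add: algebra_simps)
  note D = dvd_abs_less_eq_0[OF this small]
  show ?thesis using s(2) D(2) m22
    by (simp add: base_sigma_def algebra_simps power2_eq_square power3_eq_cube)
qed

lemma sigma_fam3:
  assumes "T \<in> fam3 (k * \<Delta> + 1 + j) \<Delta> j" and j2: "2 \<le> j" "j \<le> \<Delta> - 2"
  shows "sigma T = base_sigma (int \<Delta>) (int k) + 4 * int \<Delta> + int j ^ 3 - (int j)\<^sup>2 - 6"
proof -
  from assms(1) obtain w where T: "T \<in> trees (k * \<Delta> + 1 + j) \<Delta>"
    and il: "\<forall>v. internal_leaf T v \<longrightarrow> deg T v = \<Delta>"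
    and medium: "medium_verts T = {w}" and w: "deg T w = j + 1"
    and degs: "\<forall>v\<in>verts T - {w}. deg T v \<in> {1, 2, \<Delta>}"
    and nb2: "card {u \<in> neighbors T w. deg T u = 2} = j"
    and nbD: "card {u \<in> neighbors T w. deg T u = \<Delta>} = 1"
    and m22: "m_deg T 2 2 = 0" and mDD: "m_deg T \<Delta> \<Delta> = 0"
    by (auto simp: fam3_def)
  note G = treesD(2)[OF T]
  have wV: "w \<in> verts T" using medium by (auto simp: medium_verts_def)
  have a: "3 \<le> j + 1" "j + 1 < \<Delta>" using j2 \<Delta> by auto
  let ?N = "{u \<in> neighbors T w. deg T u = 2} \<union> {u \<in> neighbors T w. deg T u = \<Delta>}"
  \<comment> \<open>The j neighbors of degree 2 and the one of degree \<Delta> already exhaust the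
    degree of \<open>w\<close>.\<close>
  have "card ?N = j + 1"
    using \<Delta> nb2 nbD finite_neighbors[OF G, of w] by (subst card_Un_disjoint) auto
  then have "?N = neighbors T w"
    using w by (intro card_subset_eq finite_neighbors[OF G]) (auto simp: deg_def)
  then have nb: "\<forall>u\<in>neighbors T w. deg T u \<in> {2, \<Delta>}" by blast
  have small: "\<bar>int j - int j\<bar> < int \<Delta>" using \<Delta> by simp
  show ?thesis
    using sigma_one_medium(2)[OF T il wV w a degs m22 nb nb2[symmetric] mDD small]
    by (simp add: base_sigma_def algebra_simps power2_eq_square power3_eq_cube)
qed

end

section \<open>Comparing the three values\<close>

text \<open>The roots of q sum to 4 - \<Delta>, so the second one is 4 - \<Delta> - r.\<close>

lemma poly_q_factor:
  assumes "6 \<le> \<Delta>"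
  shows "poly (q_poly \<Delta>) x = (x - r_thr \<Delta>) * (x + r_thr \<Delta> + real \<Delta> - 4)"
proof -
  let ?d = "real \<Delta>"
  \<comment> \<open>The discriminant expanded around 6, where all coefficients are
    nonnegative.\<close>
  have "0 \<le> 5 * (?d - 6)\<^sup>2 + 28 * (?d - 6) + 32"
    using assms by (intro add_nonneg_nonneg) auto
  also have "\<dots> = 5 * ?d\<^sup>2 - 32 * ?d + 44"
    by (simp add: power2_eq_square algebra_simps)
  finally have "(sqrt (5 * ?d\<^sup>2 - 32 * ?d + 44))\<^sup>2 = 5 * ?d\<^sup>2 - 32 * ?d + 44"
    by simp
  moreover define s where "s = sqrt (5 * ?d\<^sup>2 - 32 * ?d + 44)"
  ultimately have "s\<^sup>2 = 5 * ?d\<^sup>2 - 32 * ?d + 44"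
    by simp
  then show ?thesis
    unfolding q_poly_def r_thr_def s_def[symmetric]
    by (simp add: field_simps power2_eq_square)
qed

lemma r_thr_pos:
  assumes "6 \<le> \<Delta>"
  shows "0 < r_thr \<Delta>"
proof -
  let ?d = "real \<Delta>"
  have "0 < 4 * (?d - 6) * ?d + 28"
    using assms by (intro add_nonneg_pos mult_nonneg_nonneg) auto
  also have "\<dots> = (5 * ?d\<^sup>2 - 32 * ?d + 44) - (?d - 4)\<^sup>2"
    by (simp add: power2_eq_square algebra_simps)
  finally have "?d - 4 < sqrt (5 * ?d\<^sup>2 - 32 * ?d + 44)"
    by (intro real_less_rsqrt) simp
  then show ?thesis by (simp add: r_thr_def)
qed

text \<open>The second factor of q is positive for positive \<open>x\<close>, so comparing j with r
  amounts to finding the sign of q(j).\<close>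

lemma sgn_poly_q:
  assumes "6 \<le> \<Delta>" "0 < x"
  shows "sgn (poly (q_poly \<Delta>) x) = sgn (x - r_thr \<Delta>)"
proof -
  have "0 < x + r_thr \<Delta> + real \<Delta> - 4"
    using assms r_thr_pos[OF assms(1)] by linarith
  then show ?thesis by (simp add: poly_q_factor[OF assms(1)] sgn_mult)
qed

lemma positive_roots_q_poly:
  assumes "6 \<le> \<Delta>"
  shows "{x. 0 < x \<and> poly (q_poly \<Delta>) x = 0} = {r_thr \<Delta>}"
proof -
  have "poly (q_poly \<Delta>) x = 0 \<longleftrightarrow> x = r_thr \<Delta>" if "0 < x" for x
    using sgn_poly_q[OF assms that] by (metis eq_iff_diff_eq_0 sgn_0_0)
  then show ?thesis using r_thr_pos[OF assms] by auto
qed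

lemma sgn_sigma1_minus_sigma2:
  fixes j \<Delta> :: nat
  assumes \<Delta>: "6 \<le> \<Delta>" and j: "1 \<le> j" "j \<le> \<Delta> - 1"
    and s1: "s1 = b + (if j \<le> 2 then 4 * int \<Delta> - 6
      else 2 * int \<Delta> * int j + int j ^ 3 - 4 * (int j)\<^sup>2 + int j)"
    and s2: "s2 = b - int \<Delta> ^ 3 + 2 * (int \<Delta>)\<^sup>2 * int j
      + 6 * (int \<Delta>)\<^sup>2 - 8 * int \<Delta> * int j - 7 * int \<Delta> + 8 * int j"
  shows "sgn (real_of_int (s1 - s2)) = sgn (r_thr \<Delta> - real j)"
proof -
  define q where "q = (int j)\<^sup>2 + (int \<Delta> - 4) * int j - ((int \<Delta>)\<^sup>2 - 6 * int \<Delta> + 7)"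
  have "real_of_int q = poly (q_poly \<Delta>) (real j)"
    by (simp add: q_def q_poly_def power2_eq_square algebra_simps)
  then have q: "sgn (real_of_int q) = sgn (real j - r_thr \<Delta>)"
    using sgn_poly_q[OF \<Delta>, of "real j"] j by simp
  have "sgn (s1 - s2) = - sgn q"
  \<comment> \<open>For j = 1 the cubic formula for sigma' fails, so both signs are computed from
    explicit factorizations. For j = 2 it also gives 4 \<Delta> - 6, so the general factorization
    applies from there on.\<close>
  proof (cases "j = 1")
    case True
    have "q = - ((int \<Delta> - 2) * (int \<Delta> - 5))"
      using True by (simp add: q_def power2_eq_square algebra_simps)
    moreover have "0 < (int \<Delta> - 2) * (int \<Delta> - 5)" using \<Delta> by simp
    moreover have "s1 - s2 = (int \<Delta> - 2) * (int \<Delta> * (int \<Delta> - 6) + 7)"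
      using True by (simp add: s1 s2 power2_eq_square power3_eq_cube algebra_simps)
    moreover have "0 < (int \<Delta> - 2) * (int \<Delta> * (int \<Delta> - 6) + 7)"
      using \<Delta> by (intro mult_pos_pos add_nonneg_pos mult_nonneg_nonneg) auto
    ultimately show ?thesis by (simp only: idom_abs_sgn_class.sgn_minus sgn_pos minus_minus)
  next
    case False
    have "s1 = b + (2 * int \<Delta> * int j + int j ^ 3 - 4 * (int j)\<^sup>2 + int j)"
    proof (cases "j \<le> 2")
      case True
      with False j have "j = 2" by simp
      then show ?thesis by (simp add: s1)
    qed (simp add: s1)
    then have "s1 - s2 = (int \<Delta> - int j) * (- q)"
      by (simp add: s2 q_def power2_eq_square power3_eq_cube algebra_simps)
    moreover have "0 < int \<Delta> - int j" using \<Delta> j by simp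
    ultimately show ?thesis by (simp only: sgn_mult idom_abs_sgn_class.sgn_minus sgn_pos mult_1)
  qed
  then have "sgn (real_of_int (s1 - s2)) = - sgn (real_of_int q)"
    by (simp add: sgn_if split: if_splits)
  also have "\<dots> = sgn (r_thr \<Delta> - real j)"
    unfolding q by (metis minus_diff_eq sgn_minus)
  finally show ?thesis .
qed

text \<open>This form shows the exceptional cases: the value is 4 at j = 2 and 18 - 2 d at j = 3,
  hence 2 for d = 8 and 0 for d = 9.\<close>

lemma sigma3_minus_sigma1:
  fixes d j :: int
  shows "(4 * d + j ^ 3 - j\<^sup>2 - 6) - (2 * d * j + j ^ 3 - 4 * j\<^sup>2 + j)
    = 4 - (j - 2) * (2 * d - 5 - 3 * j)"
  by (simp add: power2_eq_square power3_eq_cube algebra_simps)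

text \<open>For j at most d - 2 the first factor is nonpositive, so the sign of the quadratic factor
  is what matters.\<close>

lemma sigma3_minus_sigma2:
  fixes d j :: int
  shows "(4 * d + j ^ 3 - j\<^sup>2 - 6)
      - (- (d ^ 3) + 2 * d\<^sup>2 * j + 6 * d\<^sup>2 - 8 * d * j - 7 * d + 8 * j)
    = (j - (d - 2)) * (j\<^sup>2 + j * (d - 2) - (d - 2)\<^sup>2) - j\<^sup>2 - (d - 2)"
  by (simp add: power2_eq_square power3_eq_cube algebra_simps)

text \<open>The hypothesis \<open>ge\<close> says that \<open>\<sigma>'''\<close> is at least \<open>\<sigma>'\<close>. For \<open>j \<ge> 7\<close> it forces
  \<open>3 j \<ge> 2 (d - 2) - 1\<close>, hence \<open>j\<^sup>2 + j (d - 2) \<ge> (d - 2)\<^sup>2\<close>; for \<open>3 \<le> j \<le> 6\<close> it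
  leaves finitely many pairs.\<close>

lemma sigma3_less_sigma2:
  fixes d j :: int
  assumes d: "6 \<le> d" and j: "3 \<le> j" "j \<le> d - 2"
    and ex: "\<not> (d = 8 \<and> j = 3)" "\<not> (d = 9 \<and> j = 3)"
    and ge: "(j - 2) * (2 * d - 5 - 3 * j) \<le> 4"
  shows "(j - (d - 2)) * (j\<^sup>2 + j * (d - 2) - (d - 2)\<^sup>2) - j\<^sup>2 - (d - 2) < 0"
proof (cases "7 \<le> j")
  case True
  define m where "m = d - 2"
  have m: "7 \<le> m" "j \<le> m" using True j by (auto simp: m_def)
  have "2 * d - 5 - 3 * j \<le> 0"
  proof (rule ccontr)
    assume "\<not> 2 * d - 5 - 3 * j \<le> 0"
    then have "(j - 2) * 1 \<le> (j - 2) * (2 * d - 5 - 3 * j)"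
      using j by (intro mult_left_mono) auto
    also note ge
    finally show False using True by simp
  qed
  then have lo: "2 * m - 1 \<le> 3 * j" by (simp add: m_def)
  \<comment> \<open>The factor 9 clears the denominator of j >= (2 m - 1) / 3; the added term is
    what that bound leaves over, nonnegative because m >= 7.\<close>
  have "9 * m\<^sup>2 \<le> 9 * m\<^sup>2 + (m * (m - 7) + 1)"
    using m by simp
  also have "\<dots> = (2 * m - 1) * (2 * m - 1) + 3 * m * (2 * m - 1)"
    by (simp add: power2_eq_square algebra_simps)
  also have "\<dots> \<le> (3 * j) * (3 * j) + 3 * m * (3 * j)"
    using lo m by (intro add_mono mult_mono) auto
  also have "\<dots> = 9 * (j\<^sup>2 + j * m)"
    by (simp add: power2_eq_square algebra_simps)
  finally have "(j - m) * (j\<^sup>2 + j * m - m\<^sup>2) \<le> 0"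
    using m by (intro mult_nonpos_nonneg) auto
  moreover have "0 < j\<^sup>2" using True by simp
  ultimately show ?thesis using m unfolding m_def by linarith
next
  case False
  with j have "j = 3 \<or> j = 4 \<or> j = 5 \<or> j = 6" by linarith
  then show ?thesis
  proof (elim disjE)
    \<comment> \<open>Here \<open>ge\<close> gives d <= 9, and \<open>ex\<close> removes 8 and 9. In
      the later cases \<open>ge\<close> again bounds d from above, and each remaining pair is
      evaluated.\<close>
    assume j3: "j = 3"
    with ge d ex have "d = 6 \<or> d = 7" by auto
    with j3 show ?thesis by auto
  next
    assume j4: "j = 4"
    with ge d have "d = 6 \<or> d = 7 \<or> d = 8 \<or> d = 9" by auto
    with j4 show ?thesis by auto
  next
    assume j5: "j = 5"
    with ge j have "d = 7 \<or> d = 8 \<or> d = 9 \<or> d = 10" by auto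
    with j5 show ?thesis by auto
  next
    assume j6: "j = 6"
    with ge j have "d = 8 \<or> d = 9 \<or> d = 10 \<or> d = 11 \<or> d = 12" by auto
    with j6 show ?thesis by auto
  qed
qed

text \<open>The common values are represented by \<open>sigma\<close> of arbitrary members of the
  families, whose vertex types may differ. The comparisons rest on the closed forms for the
  families.\<close>

theorem proposition10:
  fixes n k j \<Delta> :: nat
  assumes "6 \<le> \<Delta>" and "n = k * \<Delta> + 1 + j" and "\<Delta> - 1 \<le> k" and "1 \<le> j" and "j \<le> \<Delta> - 1"
  shows
    "{x. 0 < x \<and> poly (q_poly \<Delta>) x = 0} = {r_thr \<Delta>} \<and>
     (\<forall>T1 \<in> (fam1 n \<Delta> :: 'a graph set). \<forall>T2 \<in> (fam2 n \<Delta> :: 'b graph set).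
        (real j < r_thr \<Delta> \<longrightarrow> sigma T1 > sigma T2) \<and>
        (real j = r_thr \<Delta> \<longrightarrow> sigma T1 = sigma T2) \<and>
        (real j > r_thr \<Delta> \<longrightarrow> sigma T2 > sigma T1)) \<and>
     (2 \<le> j \<and> j \<le> \<Delta> - 2 \<longrightarrow>
       (\<forall>T1 \<in> (fam1 n \<Delta> :: 'a graph set). \<forall>T2 \<in> (fam2 n \<Delta> :: 'b graph set).
        \<forall>T3 \<in> (fam3 n \<Delta> j :: 'c graph set).
          (\<not> (j = 2 \<and> 7 \<le> \<Delta>) \<and> (\<Delta>, j) \<noteq> (8, 3) \<and> (\<Delta>, j) \<noteq> (6, 2) \<and> (\<Delta>, j) \<noteq> (9, 3)
             \<longrightarrow> sigma T3 < max (sigma T1) (sigma T2)) \<and>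
          (j = 2 \<and> 7 \<le> \<Delta>
             \<longrightarrow> sigma T3 = sigma T1 + 4 \<and> sigma T1 + 4 > max (sigma T1) (sigma T2)) \<and>
          ((\<Delta>, j) = (8, 3)
             \<longrightarrow> sigma T3 = sigma T1 + 2 \<and> sigma T1 + 2 > max (sigma T1) (sigma T2)) \<and>
          ((\<Delta>, j) = (6, 2)
             \<longrightarrow> sigma T3 = sigma T2 \<and> sigma T2 > sigma T1) \<and>
          ((\<Delta>, j) = (9, 3)
             \<longrightarrow> sigma T3 = sigma T1 \<and> sigma T1 > sigma T2)))"
proof (intro conjI impI ballI)
  note \<Delta> = assms(1) and n = assms(2) and j = assms(4,5)
  note s1 = sigma_fam1[OF \<Delta> j, of _ k, folded n]
    and s2 = sigma_fam2[OF \<Delta> j, of _ k, folded n]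
    and s3 = sigma_fam3[OF \<Delta> j, of _ k, folded n]
  show "{x. 0 < x \<and> poly (q_poly \<Delta>) x = 0} = {r_thr \<Delta>}"
    by (rule positive_roots_q_poly[OF \<Delta>])
  fix T1 :: "'a graph" and T2 :: "'b graph"
  assume T1: "T1 \<in> fam1 n \<Delta>" and T2: "T2 \<in> fam2 n \<Delta>"
  have sgn12: "sgn (real_of_int (sigma T1 - sigma T2)) = sgn (r_thr \<Delta> - real j)"
    by (rule sgn_sigma1_minus_sigma2[OF \<Delta> j s1[OF T1] s2[OF T2]])
  show "sigma T1 > sigma T2" if "real j < r_thr \<Delta>"
    using sgn12 that by (simp add: sgn_if split: if_splits)
  show "sigma T1 = sigma T2" if "real j = r_thr \<Delta>"
    using sgn12 that by (simp add: sgn_if split: if_splits)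
  show "sigma T2 > sigma T1" if "real j > r_thr \<Delta>"
    using sgn12 that by (simp add: sgn_if split: if_splits)
  fix T3 :: "'c graph"
  assume j2: "2 \<le> j \<and> j \<le> \<Delta> - 2" and T3: "T3 \<in> fam3 n \<Delta> j"
  define d i where "d = int \<Delta>" and "i = int j"
  \<comment> \<open>The cubic formula holds from j = 2 on, so no case split remains below.\<close>
  have s1': "sigma T1 = base_sigma d (int k) + (2 * d * i + i ^ 3 - 4 * i\<^sup>2 + i)"
  proof (cases "j \<le> 2")
    case True
    with j2 have "j = 2" by simp
    then show ?thesis by (simp add: s1[OF T1] d_def i_def)
  qed (simp add: s1[OF T1] d_def i_def)
  have d31: "sigma T3 - sigma T1 = 4 - (i - 2) * (2 * d - 5 - 3 * i)"
    using sigma3_minus_sigma1[of d i] j2 by (simp add: s1' s3[OF T3] d_def i_def)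
  have d32: "sigma T3 - sigma T2
      = (i - (d - 2)) * (i\<^sup>2 + i * (d - 2) - (d - 2)\<^sup>2) - i\<^sup>2 - (d - 2)"
    using sigma3_minus_sigma2[of d i] j2 by (simp add: s2[OF T2] s3[OF T3] d_def i_def)
  show "sigma T3 < max (sigma T1) (sigma T2)"
    if ex: "\<not> (j = 2 \<and> 7 \<le> \<Delta>) \<and> (\<Delta>, j) \<noteq> (8, 3) \<and> (\<Delta>, j) \<noteq> (6, 2) \<and> (\<Delta>, j) \<noteq> (9, 3)"
  proof (cases "sigma T3 < sigma T1")
    case False
    \<comment> \<open>For j = 2, either \<Delta> = 6 or \<Delta> >= 7, and both are
      excluded.\<close>
    have "j \<noteq> 2" using ex \<Delta> by auto
    then have range: "6 \<le> d" "3 \<le> i" "i \<le> d - 2" using j2 \<Delta> unfolding d_def i_def by linarith+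
    have ex': "\<not> (d = 8 \<and> i = 3)" "\<not> (d = 9 \<and> i = 3)"
      using ex by (auto simp: d_def i_def)
    have "(i - 2) * (2 * d - 5 - 3 * i) \<le> 4"
      using False d31 by simp
    from sigma3_less_sigma2[OF range ex' this] have "sigma T3 < sigma T2"
      unfolding d32[symmetric] by simp
    then show ?thesis by simp
  qed simp
  show "sigma T3 = sigma T1 + 4" if "j = 2 \<and> 7 \<le> \<Delta>"
    using d31 that by (simp add: i_def)
  show "sigma T1 + 4 > max (sigma T1) (sigma T2)" if j7: "j = 2 \<and> 7 \<le> \<Delta>"
  proof -
    \<comment> \<open>This factorization at j = 2 also explains the equality for (6, 2).\<close>
    have "sigma T3 - sigma T2 = (d - 6) * ((d - 3) * (d - 1))"
      using d32 j7 by (simp add: i_def power2_eq_square algebra_simps)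
    moreover have "0 < (d - 6) * ((d - 3) * (d - 1))" using j7 by (simp add: d_def)
    moreover have "sigma T3 = sigma T1 + 4" using d31 j7 by (simp add: i_def)
    ultimately show ?thesis by simp
  qed
  show "sigma T3 = sigma T1 + 2" if "(\<Delta>, j) = (8, 3)"
    using d31 that by (simp add: d_def i_def)
  show "sigma T1 + 2 > max (sigma T1) (sigma T2)" if "(\<Delta>, j) = (8, 3)"
    using d31 d32 that by (simp add: d_def i_def)
  show "sigma T3 = sigma T2" if "(\<Delta>, j) = (6, 2)"
    using d32 that by (simp add: d_def i_def)
  show "sigma T2 > sigma T1" if "(\<Delta>, j) = (6, 2)"
    using d31 d32 that by (simp add: d_def i_def)
  show "sigma T3 = sigma T1" if "(\<Delta>, j) = (9, 3)"
    using d31 that by (simp add: d_def i_def)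
  show "sigma T1 > sigma T2" if "(\<Delta>, j) = (9, 3)"
    using d31 d32 that by (simp add: d_def i_def)
qed

end
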